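(* Let $n\ge 1$ and $d\ge 1$ be integers and let $\mathcal{P}$ be the AHI family of polynomials in $n$ real variables, i.e. the set of polynomials of the form $$p(x)=\Big(\sum_{i=1}^n \lambda_i x^{\alpha(i)}\Big)\Big(\sum_{i=1}^n \lambda_i \prod_{j\neq i} x^{\alpha(j)}\Big)-c\prod_{i=1}^n x^{\alpha(i)},$$ where $\lambda_1,\dots,\lambda_n\ge 0$, $c\in\mathbb{R}$, and each $x^{\alpha(i)}$ is a squared monomial in $x_1,\dots,x_n$ of degree at most $2d$. Then a polynomial $p\in\mathcal{P}$ is non-negative (on $\mathbb{R}^n$) if and only if $p$ is a sum of squares of polynomials.
   Context: A squared monomial is $x^{\alpha}=x_1^{\alpha_1}\cdots x_n^{\alpha_n}$ with all $\alpha_k$ even non-negative integers. The monomials $x^{\alpha(1)},\dots,x^{\alpha(n)}$ are not required to be distinct. A polynomial $p\in\mathbb{R}[x_1,\dots,x_n]$ is non-negative if $p(x)\ge 0$ for all $x\in\mathbb{R}^n$, and is a sum of squares (SOS) if $p=\sum_{i=1}^r f_i^2$ for some polynomials $f_i\in\mathbb{R}[x_1,\dots,x_n]$. *)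

theory Defs
  imports "HOL-Analysis.Analysis" "HOL-Library.Poly_Mapping"
begin

text \<open>
  Real polynomials in \<open>CARD('n)\<close> variables, as finitely supported maps from exponent vectors to
  coefficients; multiplication on this type is the convolution product from
  \<^theory>\<open>HOL-Library.Poly_Mapping\<close>.
\<close>

type_synonym 'n rpoly = "('n \<Rightarrow>\<^sub>0 nat) \<Rightarrow>\<^sub>0 real"

definition monomial :: "('n \<Rightarrow>\<^sub>0 nat) \<Rightarrow> 'n rpoly" where
  "monomial \<alpha> = Poly_Mapping.single \<alpha> 1"

definition Const :: "real \<Rightarrow> 'n rpoly" where
  "Const a = Poly_Mapping.single 0 a"

definition monomial_degree :: "('n::finite \<Rightarrow>\<^sub>0 nat) \<Rightarrow> nat" where
  "monomial_degree \<alpha> = (\<Sum>k\<in>UNIV. Poly_Mapping.lookup \<alpha> k)"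

definition squared_exponent :: "('n \<Rightarrow>\<^sub>0 nat) \<Rightarrow> bool" where
  "squared_exponent \<alpha> \<longleftrightarrow> (\<forall>k. even (Poly_Mapping.lookup \<alpha> k))"

definition poly_eval :: "'n::finite rpoly \<Rightarrow> real ^ 'n \<Rightarrow> real" where
  "poly_eval p x =
    (\<Sum>\<alpha>\<in>Poly_Mapping.keys p.
      Poly_Mapping.lookup p \<alpha> * (\<Prod>k\<in>UNIV. (x $ k) ^ Poly_Mapping.lookup \<alpha> k))"

definition nonneg_poly :: "'n::finite rpoly \<Rightarrow> bool" where
  "nonneg_poly p \<longleftrightarrow> (\<forall>x. poly_eval p x \<ge> 0)"

definition sum_of_squares :: "'n rpoly \<Rightarrow> bool" where
  "sum_of_squares p \<longleftrightarrow> (\<exists>(r::nat) (f :: nat \<Rightarrow> 'n rpoly). p = (\<Sum>i=1..r. (f i)\<^sup>2))"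

text \<open>
  The index type \<open>'n\<close> plays two roles: it indexes the variables and also the monomials
  \<open>x^(\<alpha> i)\<close> of the family, since there are as many monomials as variables.
\<close>

definition AHI_poly ::
    "('n::finite \<Rightarrow> real) \<Rightarrow> real \<Rightarrow> ('n \<Rightarrow> ('n \<Rightarrow>\<^sub>0 nat)) \<Rightarrow> 'n rpoly" where
  "AHI_poly l c \<alpha> =
     (\<Sum>i\<in>UNIV. Const (l i) * monomial (\<alpha> i)) *
     (\<Sum>i\<in>UNIV. Const (l i) * (\<Prod>j\<in>UNIV - {i}. monomial (\<alpha> j)))
     - Const c * (\<Prod>i\<in>UNIV. monomial (\<alpha> i))"

definition AHI_family :: "nat \<Rightarrow> 'n::finite rpoly set" where
  "AHI_family d =
     {AHI_poly l c \<alpha> | l c \<alpha>.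
        (\<forall>i. l i \<ge> 0) \<and>
        (\<forall>i. squared_exponent (\<alpha> i) \<and> monomial_degree (\<alpha> i) \<le> 2 * d)}"

end

theory Submission imports Defs begin

text \<open>
  Write each squared monomial as \<open>y\<^sub>i = m\<^sub>i\<^sup>2\<close>. Expanding the product in the definition of the
  family gives terms \<open>\<lambda>\<^sub>i \<lambda>\<^sub>j y\<^sub>i \<Prod>\<^bsub>k\<noteq>j\<^esub> y\<^sub>k\<close>. Pairing the term of \<open>(i, j)\<close> with that of
  \<open>(j, i)\<close> and completing the square, \<open>y\<^sub>i\<^sup>2 + y\<^sub>j\<^sup>2 = 2 y\<^sub>i y\<^sub>j + (y\<^sub>i - y\<^sub>j)\<^sup>2\<close>, yields the identity
  (lemma \<open>AHI_identity\<close>, there for \<open>c = 0\<close> and multiplied by two)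

  \<open>p = ((\<Sum>\<^sub>i \<lambda>\<^sub>i)\<^sup>2 - c) \<Prod>\<^sub>k m\<^sub>k\<^sup>2 + \<Sum>\<^bsub>i<j\<^esub> \<lambda>\<^sub>i \<lambda>\<^sub>j ((m\<^sub>i\<^sup>2 - m\<^sub>j\<^sup>2) \<Prod>\<^bsub>k\<notin>{i,j}\<^esub> m\<^sub>k)\<^sup>2\<close>.

  The second summand is a sum of squares because all \<open>\<lambda>\<^sub>i\<close> are non-negative. Hence \<open>p\<close> is a sum
  of squares as soon as \<open>c \<le> (\<Sum>\<^sub>i \<lambda>\<^sub>i)\<^sup>2\<close>; and this inequality is exactly what non-negativity of
  \<open>p\<close> at the single point \<open>(1, \<dots>, 1)\<close> says. The converse holds since evaluation at a point
  is a ring homomorphism.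
\<close>

section \<open>Evaluation is a ring homomorphism\<close>

lemma poly_eval_superset:
  assumes "finite A" "Poly_Mapping.keys p \<subseteq> A"
  shows "poly_eval p x =
    (\<Sum>\<alpha>\<in>A. Poly_Mapping.lookup p \<alpha> * (\<Prod>k\<in>UNIV. (x $ k) ^ Poly_Mapping.lookup \<alpha> k))"
  unfolding poly_eval_def
  by (rule sum.mono_neutral_left) (use assms in \<open>auto simp: in_keys_iff\<close>)

lemma poly_eval_add: "poly_eval (p + q) x = poly_eval p x + poly_eval q x"
proof -
  let ?A = "Poly_Mapping.keys p \<union> Poly_Mapping.keys q"
  have "Poly_Mapping.keys (p + q) \<subseteq> ?A" by (rule Poly_Mapping.keys_add)
  then show ?thesis
    by (simp add: poly_eval_superset[of ?A] lookup_add distrib_right sum.distrib)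
qed

lemma poly_eval_uminus: "poly_eval (- p) x = - poly_eval p x"
  by (simp add: poly_eval_def sum_negf)

lemma poly_eval_diff: "poly_eval (p - q) x = poly_eval p x - poly_eval q x"
  using poly_eval_add[of p "- q"] by (simp add: poly_eval_uminus)

lemma poly_eval_0 [simp]: "poly_eval 0 x = 0"
  by (simp add: poly_eval_def)

lemma poly_eval_sum: "poly_eval (\<Sum>i\<in>A. f i) x = (\<Sum>i\<in>A. poly_eval (f i) x)"
  by (induction A rule: infinite_finite_induct) (simp_all add: poly_eval_add)

lemma poly_eval_single:
  "poly_eval (Poly_Mapping.single \<alpha> a) x = a * (\<Prod>k\<in>UNIV. (x $ k) ^ Poly_Mapping.lookup \<alpha> k)"
  by (subst poly_eval_superset[of "{\<alpha>}"]) auto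

lemma rpoly_eq_sum_single:
  fixes p :: "'n rpoly"
  shows "p = (\<Sum>\<alpha>\<in>Poly_Mapping.keys p. Poly_Mapping.single \<alpha> (Poly_Mapping.lookup p \<alpha>))"
  by (rule poly_mapping_eqI) (simp add: lookup_sum lookup_single when_def in_keys_iff)

lemma poly_eval_mult: "poly_eval (p * q) x = poly_eval p x * poly_eval q x"
proof -
  have "p * q = (\<Sum>\<alpha>\<in>Poly_Mapping.keys p. \<Sum>\<beta>\<in>Poly_Mapping.keys q.
      Poly_Mapping.single (\<alpha> + \<beta>) (Poly_Mapping.lookup p \<alpha> * Poly_Mapping.lookup q \<beta>))"
    by (subst rpoly_eq_sum_single[of p], subst rpoly_eq_sum_single[of q])
       (simp add: sum_product mult_single)
  then show ?thesis
    by (simp add: poly_eval_sum poly_eval_single poly_eval_def[of p] poly_eval_def[of q]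
        sum_product lookup_add power_add prod.distrib mult_ac)
qed

lemma poly_eval_1 [simp]: "poly_eval 1 x = 1"
  using poly_eval_single[of 0 1 x] by simp

lemma poly_eval_prod: "poly_eval (\<Prod>i\<in>A. f i) x = (\<Prod>i\<in>A. poly_eval (f i) x)"
  by (induction A rule: infinite_finite_induct) (simp_all add: poly_eval_mult)

lemma poly_eval_Const: "poly_eval (Const a) x = a"
  by (simp add: Const_def poly_eval_single)

lemma poly_eval_monomial:
  "poly_eval (monomial \<alpha>) x = (\<Prod>k\<in>UNIV. (x $ k) ^ Poly_Mapping.lookup \<alpha> k)"
  by (simp add: monomial_def poly_eval_single)

lemma poly_eval_AHI_poly_ones: "poly_eval (AHI_poly l c \<alpha>) 1 = (\<Sum>i\<in>UNIV. l i)\<^sup>2 - c"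
  by (simp add: AHI_poly_def poly_eval_diff poly_eval_mult poly_eval_sum poly_eval_prod
      poly_eval_Const poly_eval_monomial power2_eq_square)

lemma sum_of_squares_imp_nonneg: "sum_of_squares p \<Longrightarrow> nonneg_poly p"
  by (auto simp: sum_of_squares_def nonneg_poly_def poly_eval_sum power2_eq_square
      poly_eval_mult intro!: sum_nonneg)

section \<open>The cone of sums of squares\<close>

lemma Const_mult: "Const (a * b) = Const a * Const b"
  by (simp add: Const_def mult_single)

lemma Const_add: "Const (a + b) = Const a + Const b"
  by (simp add: Const_def single_add)

lemma Const_diff: "Const (a - b) = Const a - Const b"
  by (simp add: Const_def single_diff)

lemma Const_0 [simp]: "Const 0 = 0"
  by (simp add: Const_def)

lemma Const_sum: "Const (\<Sum>i\<in>A. f i) = (\<Sum>i\<in>A. Const (f i))"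
  by (induction A rule: infinite_finite_induct) (simp_all add: Const_add)

lemma Const_1 [simp]: "Const 1 = 1"
  by (simp add: Const_def)

lemma sum_of_squares_0: "sum_of_squares 0"
  unfolding sum_of_squares_def by (rule exI[of _ 0]) simp

lemma sum_of_squares_add_square:
  assumes "sum_of_squares p"
  shows "sum_of_squares (p + f\<^sup>2)"
proof -
  obtain r g where p: "p = (\<Sum>i=1..(r::nat). (g i)\<^sup>2)"
    using assms by (auto simp: sum_of_squares_def)
  have "p + f\<^sup>2 = (\<Sum>i=1..Suc r. ((g(Suc r := f)) i)\<^sup>2)"
    unfolding p by simp
  then show ?thesis unfolding sum_of_squares_def by blast
qed

lemma sum_of_squares_add_scaled_square:
  assumes "sum_of_squares p" "0 \<le> a"
  shows "sum_of_squares (p + Const a * f\<^sup>2)"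
proof -
  have "Const a * f\<^sup>2 = (Const (sqrt a) * f)\<^sup>2"
    using assms(2) by (simp add: power_mult_distrib power2_eq_square[of "Const _"] flip: Const_mult)
  then show ?thesis using sum_of_squares_add_square[OF assms(1)] by metis
qed

lemma sum_of_squares_add_scaled_sum:
  assumes "sum_of_squares p" "\<And>i. i \<in> A \<Longrightarrow> 0 \<le> a i"
  shows "sum_of_squares (p + (\<Sum>i\<in>A. Const (a i) * (f i)\<^sup>2))"
  using assms(2)
proof (induction A rule: infinite_finite_induct)
  case (insert i A)
  then have "sum_of_squares ((p + (\<Sum>i\<in>A. Const (a i) * (f i)\<^sup>2)) + Const (a i) * (f i)\<^sup>2)"
    by (intro sum_of_squares_add_scaled_square) auto
  then show ?case using insert by (simp add: add_ac)
qed (use assms(1) in auto)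

section \<open>Completing the square\<close>

text \<open>
  For \<open>i \<noteq> j\<close> both products on the left contain the square of one of the two distinguished factors
  and share the cofactor \<open>\<Prod>\<^bsub>k\<notin>{i,j}\<^esub> (m k)\<^sup>2\<close>. For \<open>i = j\<close> the square vanishes, so sums over all
  ordered pairs need no case distinction.
\<close>

lemma paired_products:
  fixes m :: "'i::finite \<Rightarrow> 'a::comm_ring_1"
  shows "(m i)\<^sup>2 * (\<Prod>k\<in>UNIV-{j}. (m k)\<^sup>2) + (m j)\<^sup>2 * (\<Prod>k\<in>UNIV-{i}. (m k)\<^sup>2)
    = 2 * (\<Prod>k\<in>UNIV. (m k)\<^sup>2) + (((m i)\<^sup>2 - (m j)\<^sup>2) * (\<Prod>k\<in>UNIV-{i,j}. m k))\<^sup>2"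
proof (cases "i = j")
  case True
  have "(\<Prod>k\<in>UNIV. (m k)\<^sup>2) = (m j)\<^sup>2 * (\<Prod>k\<in>UNIV-{j}. (m k)\<^sup>2)"
    by (rule prod.remove) auto
  then show ?thesis using True by simp
next
  case False
  define Q where "Q = (\<Prod>k\<in>UNIV-{i,j}. (m k)\<^sup>2)"
  have j: "(\<Prod>k\<in>UNIV-{j}. (m k)\<^sup>2) = (m i)\<^sup>2 * Q"
    using False prod.remove[of "UNIV-{j}" i "\<lambda>k. (m k)\<^sup>2"]
    by (simp add: Q_def insert_commute flip: Diff_insert)
  have i: "(\<Prod>k\<in>UNIV-{i}. (m k)\<^sup>2) = (m j)\<^sup>2 * Q"
    using False prod.remove[of "UNIV-{i}" j "\<lambda>k. (m k)\<^sup>2"]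
    by (simp add: Q_def insert_commute flip: Diff_insert)
  have all: "(\<Prod>k\<in>UNIV. (m k)\<^sup>2) = (m i)\<^sup>2 * (\<Prod>k\<in>UNIV-{i}. (m k)\<^sup>2)"
    by (rule prod.remove) auto
  have sq: "(\<Prod>k\<in>UNIV-{i,j}. m k)\<^sup>2 = Q"
    by (simp add: Q_def prod_power_distrib)
  show ?thesis
    unfolding power_mult_distrib sq all i j by (simp add: algebra_simps power2_eq_square)
qed

text \<open>
  The factor two comes from summing over ordered instead of unordered pairs, which avoids an
  ordering of the index type.
\<close>

lemma AHI_identity:
  fixes m a :: "'i::finite \<Rightarrow> 'a::comm_ring_1"
  shows "2 * ((\<Sum>i\<in>UNIV. a i * (m i)\<^sup>2) * (\<Sum>i\<in>UNIV. a i * (\<Prod>j\<in>UNIV-{i}. (m j)\<^sup>2)))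
    = 2 * ((\<Sum>i\<in>UNIV. a i)\<^sup>2 * (\<Prod>k\<in>UNIV. m k)\<^sup>2)
      + (\<Sum>i\<in>UNIV. \<Sum>j\<in>UNIV. a i * a j *
          (((m i)\<^sup>2 - (m j)\<^sup>2) * (\<Prod>k\<in>UNIV-{i,j}. m k))\<^sup>2)"
    (is "2 * (?A * ?B) = _ + ?R")
proof -
  define T where "T i j = (m i)\<^sup>2 * (\<Prod>k\<in>UNIV-{j}. (m k)\<^sup>2)" for i j
  have AB: "?A * ?B = (\<Sum>i\<in>UNIV. \<Sum>j\<in>UNIV. a i * a j * T i j)"
    unfolding sum_product T_def by (simp add: mult_ac)
  have BA: "?A * ?B = (\<Sum>i\<in>UNIV. \<Sum>j\<in>UNIV. a i * a j * T j i)"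
    unfolding AB by (subst sum.swap) (simp add: mult_ac)
  have "2 * (?A * ?B) = (\<Sum>i\<in>UNIV. \<Sum>j\<in>UNIV. a i * a j * (T i j + T j i))"
    unfolding mult_2 by (subst (1) AB, subst BA) (simp add: sum.distrib distrib_left)
  also have "\<dots> = (\<Sum>i\<in>UNIV. \<Sum>j\<in>UNIV. a i * a j * (2 * (\<Prod>k\<in>UNIV. (m k)\<^sup>2))) + ?R"
    unfolding T_def paired_products by (simp add: sum.distrib distrib_left)
  also have "(\<Sum>i\<in>UNIV. \<Sum>j\<in>UNIV. a i * a j * (2 * (\<Prod>k\<in>UNIV. (m k)\<^sup>2)))
      = 2 * ((\<Sum>i\<in>UNIV. a i)\<^sup>2 * (\<Prod>k\<in>UNIV. m k)\<^sup>2)"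
    by (simp add: power2_eq_square[of "sum a UNIV"] prod_power_distrib
        mult_ac sum_distrib_left sum_distrib_right)
  finally show ?thesis .
qed

lemma squared_exponent_imp_square:
  fixes \<alpha> :: "'n::finite \<Rightarrow>\<^sub>0 nat"
  assumes "squared_exponent \<alpha>"
  obtains \<beta> where "monomial \<alpha> = (monomial \<beta>)\<^sup>2"
proof -
  define \<beta> where "\<beta> = Poly_Mapping.map (\<lambda>n. n div 2) \<alpha>"
  have "\<alpha> = \<beta> + \<beta>"
  proof (rule poly_mapping_eqI)
    fix k
    have "even (Poly_Mapping.lookup \<alpha> k)"
      using assms by (simp add: squared_exponent_def)
    then show "Poly_Mapping.lookup \<alpha> k = Poly_Mapping.lookup (\<beta> + \<beta>) k"
      by (auto simp: \<beta>_def lookup_add map.rep_eq when_def)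
  qed
  then have "monomial \<alpha> = (monomial \<beta>)\<^sup>2"
    by (simp add: monomial_def power2_eq_square mult_single)
  then show ?thesis by (rule that)
qed

lemma AHI_poly_sum_of_squares:
  fixes l :: "'n::finite \<Rightarrow> real"
  assumes l: "\<And>i. 0 \<le> l i" and sq: "\<And>i. squared_exponent (\<alpha> i)"
    and c: "c \<le> (\<Sum>i\<in>UNIV. l i)\<^sup>2"
  shows "sum_of_squares (AHI_poly l c \<alpha>)"
proof -
  have "\<forall>i. \<exists>m. monomial (\<alpha> i) = m\<^sup>2"
    using sq squared_exponent_imp_square by metis
  then obtain m where m: "\<And>i. monomial (\<alpha> i) = (m i)\<^sup>2" by metis
  define M where "M = (\<Prod>k\<in>UNIV. m k)"
  define D where "D i j = ((m i)\<^sup>2 - (m j)\<^sup>2) * (\<Prod>k\<in>UNIV-{i,j}. m k)" for i j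
  define s where "s = (\<Sum>i\<in>UNIV. l i)"
  define E where "E = (\<Sum>i\<in>UNIV. \<Sum>j\<in>UNIV. Const (l i) * Const (l j) * (D i j)\<^sup>2)"
  have two: "Const (1/2) * (2 * q) = q" for q :: "'n rpoly"
  proof -
    have "Const (1/2) * (2 * q) = Const (1/2 + 1/2) * q"
      unfolding Const_add by (simp add: algebra_simps)
    then show ?thesis by simp
  qed
  have "2 * AHI_poly l c \<alpha> = 2 * ((Const s)\<^sup>2 * M\<^sup>2) + E - 2 * (Const c * M\<^sup>2)"
    unfolding AHI_poly_def m right_diff_distrib AHI_identity
    by (simp add: s_def Const_sum M_def D_def E_def prod_power_distrib)
  also have "\<dots> = 2 * (Const (s\<^sup>2 - c) * M\<^sup>2) + E"
    by (simp add: Const_diff Const_mult power2_eq_square[of s] power2_eq_square[of "Const s"]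
        algebra_simps)
  finally have "Const (1/2) * (2 * AHI_poly l c \<alpha>)
      = Const (1/2) * (2 * (Const (s\<^sup>2 - c) * M\<^sup>2)) + Const (1/2) * E"
    by (simp only: distrib_left)
  then have "AHI_poly l c \<alpha> = Const (s\<^sup>2 - c) * M\<^sup>2 + Const (1/2) * E"
    unfolding two .
  also have "Const (1/2) * E
      = (\<Sum>(i,j)\<in>UNIV. Const (1/2 * (l i * l j)) * (D i j)\<^sup>2)"
    unfolding E_def Const_mult
    by (simp add: sum_distrib_left sum.cartesian_product case_prod_beta mult.assoc)
  finally have "AHI_poly l c \<alpha> = 0 + Const (s\<^sup>2 - c) * M\<^sup>2
      + (\<Sum>z\<in>UNIV. Const (1/2 * (l (fst z) * l (snd z))) * (D (fst z) (snd z))\<^sup>2)"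
    by (simp add: case_prod_beta)
  moreover have "sum_of_squares \<dots>"
    using c l by (intro sum_of_squares_add_scaled_sum sum_of_squares_add_scaled_square
        sum_of_squares_0) (auto simp: s_def)
  ultimately show ?thesis by simp
qed

theorem mainTheorem1:
  fixes d :: nat and p :: "'n::finite rpoly"
  assumes "d \<ge> 1" and "p \<in> AHI_family d"
  shows "nonneg_poly p \<longleftrightarrow> sum_of_squares p"
proof
  assume nonneg: "nonneg_poly p"
  obtain l c \<alpha> where p: "p = AHI_poly l c \<alpha>" and "\<And>i. 0 \<le> l i" "\<And>i. squared_exponent (\<alpha> i)"
    using assms(2) by (auto simp: AHI_family_def)
  moreover have "c \<le> (\<Sum>i\<in>UNIV. l i)\<^sup>2"
    using nonneg poly_eval_AHI_poly_ones[of l c \<alpha>] unfolding nonneg_poly_def p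
    by (metis diff_ge_0_iff_ge)
  ultimately show "sum_of_squares p"
    unfolding p by (intro AHI_poly_sum_of_squares)
qed (rule sum_of_squares_imp_nonneg)

end
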